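(* Let $G$ be a Hausdorff topological group and let $\Gamma$ be a semigroup of bi-continuous automorphisms of $G$. Suppose $K$ is a compact subgroup of $G$ such that $\gamma(K)=K$ for all $\gamma\in\Gamma$. Then the following are equivalent: (1) the $\Gamma$-action on $G$ is distal; (2) the $\Gamma$-actions on both $K$ and $G/K$ are distal.
   Context: A semigroup $\Gamma$ acting on a Hausdorff space $X$ by continuous self-maps acts distally if for any two distinct $x,y\in X$ the closure of $\{(\gamma(x),\gamma(y)) : \gamma\in\Gamma\}$ in $X\times X$ does not intersect the diagonal $\{(a,a): a\in X\}$. Here $G/K$ is the space of cosets $xK$ with the quotient topology ($K$ is not assumed normal), and $\Gamma$ acts on it by $\gamma(xK)=\gamma(x)K$; $\Gamma$ acts on $K$ by restriction. *)

theory Defs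
  imports "HOL-Analysis.Analysis" "HOL-Algebra.Left_Coset" "HOL-Algebra.Bij"
begin

locale topological_group = group G for G (structure) +
  fixes T :: "'a topology"
  assumes topspace_eq_carrier: "topspace T = carrier G"
    and continuous_mult: "continuous_map (prod_topology T T) T (\<lambda>(x, y). x \<otimes> y)"
    and continuous_inv: "continuous_map T T (\<lambda>x. inv x)"

definition quotient_topology :: "'a topology \<Rightarrow> ('a \<Rightarrow> 'b) \<Rightarrow> 'b topology" where
  "quotient_topology X f =
     topology (\<lambda>U. U \<subseteq> f ` topspace X \<and> openin X {x \<in> topspace X. f x \<in> U})"

lemma openin_quotient_topology:
  "openin (quotient_topology X f) U \<longleftrightarrow>
     U \<subseteq> f ` topspace X \<and> openin X {x \<in> topspace X. f x \<in> U}"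
proof -
  let ?L = "\<lambda>U. U \<subseteq> f ` topspace X \<and> openin X {x \<in> topspace X. f x \<in> U}"
  have "istopology ?L"
    unfolding istopology_def
  proof (intro conjI allI impI)
    fix S U assume "?L S" "?L U"
    moreover have "{x \<in> topspace X. f x \<in> S \<inter> U} =
        {x \<in> topspace X. f x \<in> S} \<inter> {x \<in> topspace X. f x \<in> U}"
      by blast
    ultimately show "S \<inter> U \<subseteq> f ` topspace X" "openin X {x \<in> topspace X. f x \<in> S \<inter> U}"
      by (auto simp only: openin_Int)
  next
    fix \<K> assume K: "\<forall>S\<in>\<K>. ?L S"
    then show "\<Union>\<K> \<subseteq> f ` topspace X" by blast
    have "{x \<in> topspace X. f x \<in> \<Union>\<K>} = (\<Union>S\<in>\<K>. {x \<in> topspace X. f x \<in> S})"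
      by blast
    then show "openin X {x \<in> topspace X. f x \<in> \<Union>\<K>}"
      using K by (simp only: openin_Union) blast
  qed
  then show ?thesis
    by (simp add: quotient_topology_def)
qed

lemma topspace_quotient_topology: "topspace (quotient_topology X f) = f ` topspace X"
proof
  have "{x \<in> topspace X. f x \<in> f ` topspace X} = topspace X"
    by blast
  then have "openin (quotient_topology X f) (f ` topspace X)"
    by (simp add: openin_quotient_topology)
  then show "f ` topspace X \<subseteq> topspace (quotient_topology X f)"
    by (rule openin_subset)
  show "topspace (quotient_topology X f) \<subseteq> f ` topspace X"
    using openin_quotient_topology openin_topspace by metis
qed

lemma quotient_map_quotient_topology: "quotient_map X (quotient_topology X f) f"
  unfolding quotient_map_def
  by (auto simp: topspace_quotient_topology openin_quotient_topology)

definition coset_space :: "('a, 'b) monoid_scheme \<Rightarrow> 'a topology \<Rightarrow> 'a set \<Rightarrow> 'a set topology" where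
  "coset_space G T K = quotient_topology T (\<lambda>x. x <#\<^bsub>G\<^esub> K)"

lemma (in topological_group) topspace_coset_space: "topspace (coset_space G T K) = lcosets K"
  by (auto simp: coset_space_def topspace_quotient_topology topspace_eq_carrier LCOSETS_def)

(* The union runs over all representatives x of C; the cosets \<gamma>(x)K coincide when \<gamma> is an
   endomorphism with \<gamma>(K) \<subseteq> K, see coset_map_l_coset. *)
definition coset_map :: "('a, 'b) monoid_scheme \<Rightarrow> 'a set \<Rightarrow> ('a \<Rightarrow> 'a) \<Rightarrow> 'a set \<Rightarrow> 'a set" where
  "coset_map G K \<gamma> C = (\<Union>x\<in>C. \<gamma> x <#\<^bsub>G\<^esub> K)"

lemma (in group) coset_map_l_coset:
  assumes K: "subgroup K G" and hom: "\<gamma> \<in> hom G G" and inv: "\<gamma> ` K \<subseteq> K"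
    and x: "x \<in> carrier G"
  shows "coset_map G K \<gamma> (x <# K) = \<gamma> x <# K"
proof -
  have eq: "\<gamma> y <# K = \<gamma> x <# K" if y: "y \<in> x <# K" for y
  proof -
    obtain k where k: "k \<in> K" "y = x \<otimes> k"
      using y by (auto simp: l_coset_def)
    have "\<gamma> y = \<gamma> x \<otimes> \<gamma> k"
      using hom_mult[OF hom x subgroup.mem_carrier[OF K k(1)]] k(2) by simp
    moreover have "\<gamma> k \<in> K"
      using inv k(1) by blast
    ultimately have "\<gamma> y \<in> \<gamma> x <# K"
      by (auto simp: l_coset_def)
    then show ?thesis
      using l_repr_independence[OF _ hom_in_carrier[OF hom x] K] by simp
  qed
  moreover have "x \<in> x <# K"
    by (rule lcos_self[OF x K])
  ultimately show ?thesis
    unfolding coset_map_def by blast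
qed

(* "act g" is the self-map of X by which g \<in> S acts; only its values on topspace X matter. *)
definition distal_action :: "'s set \<Rightarrow> 'x topology \<Rightarrow> ('s \<Rightarrow> 'x \<Rightarrow> 'x) \<Rightarrow> bool" where
  "distal_action S X act \<longleftrightarrow>
     (\<forall>x\<in>topspace X. \<forall>y\<in>topspace X. x \<noteq> y \<longrightarrow>
        prod_topology X X closure_of {(act g x, act g y) | g. g \<in> S} \<inter>
          {(a, a) | a. a \<in> topspace X} = {})"

end

theory Submission
  imports Defs
begin

text \<open>
  Distality of automorphisms of \<open>G\<close> means that \<open>\<one>\<close> is not a limit of \<open>\<gamma>(z)\<close> for \<open>z \<noteq> \<one>\<close>.
  If \<open>K\<close> and \<open>G/K\<close> are distal and \<open>\<gamma>(z) \<rightarrow> \<one>\<close>, then \<open>\<gamma>(zK) \<rightarrow> K\<close>, so \<open>z \<in> K\<close>, so \<open>z = \<one>\<close>.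

  Conversely, if \<open>\<gamma>(xK)\<close> and \<open>\<gamma>(yK)\<close> have a common limit, then by compactness of \<open>K\<close> the orbit of
  \<open>z = x\<inverse>y\<close> accumulates at some \<open>k \<in> K\<close>. By Tychonoff's theorem, \<open>\<gamma>(z) \<rightarrow> k\<close> and \<open>\<gamma> \<rightarrow> \<phi>\<close> pointwise
  on \<open>K\<close> along a common net. Limits of a distal semigroup on a compact space are surjective (Ellis),
  so \<open>k = \<phi>(k')\<close> with \<open>k' \<in> K\<close>; then \<open>\<gamma>(k'\<inverse>z) \<rightarrow> \<one>\<close>, and distality of \<open>G\<close> gives \<open>z = k' \<in> K\<close>.
\<close>

section \<open>Idempotents in compact semigroups\<close>

text \<open>Compactness gives a minimal nonempty closed subsemigroup, and any \<open>u\<close> in it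
  is idempotent, because the right multiples of \<open>u\<close> and the stabiliser of
  \<open>u\<close> are again closed subsemigroups. Continuity is asked in the left argument alone:
  in a closure of a semigroup of maps, composition is continuous in the outer map for each fixed
  inner one.\<close>

lemma Ellis_Numakura:
  assumes cpt: "compact_space Y" and haus: "Hausdorff_space Y" and ne: "topspace Y \<noteq> {}"
    and cont: "\<And>q. q \<in> topspace Y \<Longrightarrow> continuous_map Y Y (\<lambda>p. m p q)"
    and assoc: "\<And>p q r. \<lbrakk>p \<in> topspace Y; q \<in> topspace Y; r \<in> topspace Y\<rbrakk>
                  \<Longrightarrow> m (m p q) r = m p (m q r)"
  shows "\<exists>u\<in>topspace Y. m u u = u"
proof -
  have m_in: "m p q \<in> topspace Y" if "p \<in> topspace Y" "q \<in> topspace Y" for p q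
    using cont[OF that(2)] that(1) by (auto simp: continuous_map_def)
  \<comment> \<open>Complements of nonempty closed subsemigroups, so that Zorn's lemma for \<open>\<subseteq>\<close> yields a minimal one.\<close>
  define \<B> where "\<B> = {U. openin Y U \<and> U \<noteq> topspace Y \<and>
    (\<forall>p\<in>topspace Y - U. \<forall>q\<in>topspace Y - U. m p q \<notin> U)}"
  have "\<exists>U\<in>\<B>. \<forall>V\<in>\<B>. U \<subseteq> V \<longrightarrow> V = U"
  proof (rule subset_Zorn_nonempty)
    show "\<B> \<noteq> {}"
    proof -
      have "{} \<in> \<B>"
        using ne openin_empty[of Y] unfolding \<B>_def by blast
      then show ?thesis
        by blast
    qed
    fix \<C> assume "\<C> \<noteq> {}" and chain: "subset.chain \<B> \<C>"
    have sub: "\<C> \<subseteq> \<B>"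
      using chain unfolding subset_chain_def by blast
    \<comment> \<open>If the union were everything, finitely many members would cover
      \<open>Y\<close>; in a chain their union is one of them, but members of \<open>\<B>\<close>
      are proper.\<close>
    have "\<Union>\<C> \<noteq> topspace Y"
    proof
      assume "\<Union>\<C> = topspace Y"
      moreover have "\<forall>U\<in>\<C>. openin Y U"
        using sub by (auto simp: \<B>_def)
      ultimately obtain \<F> where \<F>: "finite \<F>" "\<F> \<subseteq> \<C>" "topspace Y \<subseteq> \<Union>\<F>"
        using cpt unfolding compact_space_alt by (metis order_refl)
      have "\<F> \<noteq> {}"
        using \<F>(3) ne by (metis Union_empty subset_empty)
      moreover have "subset.chain \<B> \<F>"
        unfolding subset_chain_def
      proof (intro conjI ballI)
        show "\<F> \<subseteq> \<B>"
          using \<F>(2) sub by (rule subset_trans)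
        fix U V assume "U \<in> \<F>" "V \<in> \<F>"
        then have "U \<in> \<C>" "V \<in> \<C>"
          using \<F>(2) by (auto dest: subsetD)
        then show "U \<subseteq> V \<or> V \<subseteq> U"
          using chain by (simp add: subset_chain_def)
      qed
      ultimately have "\<Union>\<F> \<in> \<F>"
        by (rule Union_in_chain[OF \<F>(1)])
      then have "\<Union>\<F> \<in> \<B>"
        using \<F>(2) sub by blast
      then show False
        using \<F>(3) openin_subset unfolding \<B>_def by blast
    qed
    moreover have "openin Y (\<Union>\<C>)"
      using sub by (auto simp: \<B>_def)
    ultimately show "\<Union>\<C> \<in> \<B>"
      using sub unfolding \<B>_def by blast
  qed
  then obtain U where U: "U \<in> \<B>" and max: "\<And>V. V \<in> \<B> \<Longrightarrow> U \<subseteq> V \<Longrightarrow> V = U"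
    by blast
  define M where "M = topspace Y - U"
  have M: "closedin Y M" "M \<noteq> {}" "M \<subseteq> topspace Y"
    and M_mult: "\<And>p q. p \<in> M \<Longrightarrow> q \<in> M \<Longrightarrow> m p q \<in> M"
    using U openin_subset m_in by (auto simp: M_def \<B>_def)
  have minimal: "A = M"
    if "closedin Y A" "A \<noteq> {}" "A \<subseteq> M" "\<And>p q. p \<in> A \<Longrightarrow> q \<in> A \<Longrightarrow> m p q \<in> A" for A
  proof -
    have AY: "A \<subseteq> topspace Y"
      using that(1) closedin_subset by blast
    have "topspace Y - A \<in> \<B>"
      using that AY by (auto simp: \<B>_def closedin_def)
    moreover have "U \<subseteq> topspace Y - A"
      using that(3) U openin_subset by (fastforce simp: M_def \<B>_def)
    ultimately have "topspace Y - A = U"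
      by (rule max)
    then show ?thesis
      using AY by (auto simp: M_def)
  qed
  obtain u where u: "u \<in> M"
    using M by blast
  then have uY: "u \<in> topspace Y"
    using M by blast
  \<comment> \<open>The image is compact, hence closed, and a subsemigroup by associativity.
    Equality puts \<open>u\<close> itself in the image, which makes the stabiliser of
    \<open>u\<close> below nonempty.\<close>
  have "(\<lambda>p. m p u) ` M = M"
  proof (rule minimal)
    show "closedin Y ((\<lambda>p. m p u) ` M)"
      by (rule compactin_imp_closedin[OF haus image_compactin[OF closedin_compact_space[OF cpt M(1)] cont[OF uY]]])
    show "(\<lambda>p. m p u) ` M \<noteq> {}" "(\<lambda>p. m p u) ` M \<subseteq> M"
      using M M_mult u by auto
    fix p q assume "p \<in> (\<lambda>p. m p u) ` M" "q \<in> (\<lambda>p. m p u) ` M"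
    then obtain p' where p': "p' \<in> M" "p = m p' u" and q: "q \<in> M"
      using M_mult u by auto
    obtain q' where q': "q' \<in> M" "q = m q' u"
      using \<open>q \<in> (\<lambda>p. m p u) ` M\<close> by auto
    have "m p q = m (m p q') u"
      using p' q' u M(3) M_mult by (simp add: assoc subset_iff)
    then show "m p q \<in> (\<lambda>p. m p u) ` M"
      using M_mult p' q' u by blast
  qed
  then obtain p where p: "p \<in> M" "m p u = u"
    using u by (metis imageE)
  \<comment> \<open>Once the stabiliser of \<open>u\<close> is all of \<open>M\<close>, it contains
    \<open>u\<close>, so \<open>m u u = u\<close>.\<close>
  have "{q \<in> M. m q u = u} = M"
  proof (rule minimal)
    have "closedin Y {q \<in> topspace Y. m q u \<in> {u}}"
      by (rule closedin_continuous_map_preimage[OF cont[OF uY]])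
        (simp add: closedin_Hausdorff_sing_eq[OF haus] uY)
    then have "closedin Y (M \<inter> {q \<in> topspace Y. m q u \<in> {u}})"
      using M(1) by blast
    moreover have "M \<inter> {q \<in> topspace Y. m q u \<in> {u}} = {q \<in> M. m q u = u}"
      using M(3) by auto
    ultimately show "closedin Y {q \<in> M. m q u = u}"
      by simp
    show "{q \<in> M. m q u = u} \<noteq> {}"
      using p by blast
    show "{q \<in> M. m q u = u} \<subseteq> M"
      by blast
    show "m q r \<in> {q \<in> M. m q u = u}" if "q \<in> {q \<in> M. m q u = u}" "r \<in> {q \<in> M. m q u = u}" for q r
      using that M(3) uY by (auto simp: assoc M_mult subset_iff)
  qed
  then show ?thesis
    using u uY by blast
qed

section \<open>The enveloping semigroup of a distal action\<close>

text \<open>The pointwise closure \<open>E\<close> of \<open>F\<close> is a compact semigroup of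
  injective maps. An idempotent in it must be the identity, which yields a left inverse of
  \<open>\<phi>\<close> inside \<open>E\<close>; as this inverse is injective too, it is also a
  right inverse. Maps are extensional and composed by \<open>compose\<close> so that they are points
  of the product over \<open>topspace X\<close>, where Tychonoff's theorem applies.\<close>

lemma distal_closure_surjective:
  assumes cpt: "compact_space X" and haus: "Hausdorff_space X"
    and cont: "\<And>f. f \<in> F \<Longrightarrow> continuous_map X X f"
    and ext: "F \<subseteq> extensional (topspace X)"
    and comp: "\<And>f g. f \<in> F \<Longrightarrow> g \<in> F \<Longrightarrow> compose (topspace X) f g \<in> F"
    and distal: "distal_action F X (\<lambda>f. f)"
    and \<phi>: "\<phi> \<in> product_topology (\<lambda>_. X) (topspace X) closure_of F"
  shows "\<phi> ` topspace X = topspace X"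
proof -
  let ?S = "topspace X"
  let ?P = "product_topology (\<lambda>_. X) ?S"
  let ?c = "compose ?S"
  define E where "E = ?P closure_of F"
  have E_PiE: "E \<subseteq> ?S \<rightarrow>\<^sub>E ?S"
    using closure_of_subset_topspace[of ?P F] by (simp add: E_def)
  have E_in: "p x \<in> ?S" if "p \<in> E" "x \<in> ?S" for p x
    using that E_PiE by blast
  have F_top: "F \<subseteq> topspace ?P"
    using cont ext by (auto simp: continuous_map_def PiE_def)
  have FE: "F \<subseteq> E"
    unfolding E_def by (rule closure_of_subset[OF F_top])
  have cpt_P: "compact_space ?P" and haus_P: "Hausdorff_space ?P"
    using cpt haus by (auto simp: compact_space_product_topology Hausdorff_space_product_topology)
  have clo_E: "closedin ?P E"
    by (simp add: E_def)
  have E_minimal: "h ` E \<subseteq> E" if "continuous_map ?P ?P h" "h ` F \<subseteq> E" for h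
    using continuous_map_image_closure_subset[OF that(1), of F] closure_of_minimal[OF that(2) clo_E]
    by (simp add: E_def)
  \<comment> \<open>The outer map must be continuous here, which holds on \<open>F\<close>, whereas
    a pointwise limit in \<open>E\<close> may be discontinuous.\<close>
  have cont_comp_left: "continuous_map ?P ?P (\<lambda>q. ?c f q)" if "continuous_map X X f" for f
    unfolding continuous_map_componentwise
  proof (intro conjI ballI)
    fix x assume x: "x \<in> ?S"
    have "continuous_map ?P X (f \<circ> (\<lambda>q. q x))"
      by (rule continuous_map_compose[OF continuous_map_product_projection[OF x] that])
    then show "continuous_map ?P X (\<lambda>q. ?c f q x)"
      using x by (simp add: compose_eq o_def)
  qed (auto simp: compose_def)
  \<comment> \<open>With the inner map fixed, the coordinate of \<open>?c p q\<close> at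
    \<open>x\<close> is the coordinate of \<open>p\<close> at \<open>q x\<close>, so
    \<open>q\<close> itself may be any limit.\<close>
  have cont_comp_right: "continuous_map ?P ?P (\<lambda>p. ?c p q)" if "q \<in> E" for q
    unfolding continuous_map_componentwise
  proof (intro conjI ballI)
    fix x assume x: "x \<in> ?S"
    show "continuous_map ?P X (\<lambda>p. ?c p q x)"
      using continuous_map_product_projection[OF E_in[OF that x], of "\<lambda>_. X"] x
      by (simp add: compose_eq)
  qed (auto simp: compose_def)
  \<comment> \<open>Closure of \<open>E\<close> under composition takes two limits: first in the
    inner map with the outer one in \<open>F\<close>, then in the outer map.\<close>
  have F_E_comp: "?c f q \<in> E" if "f \<in> F" "q \<in> E" for f q
    using E_minimal[OF cont_comp_left[OF cont[OF that(1)]]] comp that FE by blast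
  have E_comp: "?c p q \<in> E" if "p \<in> E" "q \<in> E" for p q
    using E_minimal[OF cont_comp_right[OF that(2)]] F_E_comp that by blast
  \<comment> \<open>If p x = p y, then (p x, p y) is a diagonal limit of the orbit of (x, y).\<close>
  have inj: "inj_on p ?S" if "p \<in> E" for p
  proof (rule inj_onI, rule ccontr)
    fix x y assume xy: "x \<in> ?S" "y \<in> ?S" "p x = p y" "x \<noteq> y"
    have "continuous_map ?P (prod_topology X X) (\<lambda>f. (f x, f y))"
      using xy by (intro continuous_map_pairedI continuous_map_product_projection)
    from continuous_map_image_closure_subset[OF this, of F]
    have "(p x, p y) \<in> prod_topology X X closure_of {(f x, f y) | f. f \<in> F}"
      using that by (auto simp: E_def image_def Setcompr_eq_image)
    then show False
      using distal xy E_in[OF that xy(1)] unfolding distal_action_def by fastforce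
  qed
  have \<phi>E: "\<phi> \<in> E"
    using \<phi> by (simp add: E_def)
  \<comment> \<open>The left ideal generated by \<open>\<phi>\<close> contains an idempotent, which is the identity since it is injective.\<close>
  define L where "L = (\<lambda>p. ?c p \<phi>) ` E"
  have LE: "L \<subseteq> E"
    using E_comp \<phi>E by (auto simp: L_def)
  have clo_L: "closedin ?P L"
    unfolding L_def
    by (rule compactin_imp_closedin[OF haus_P image_compactin[OF closedin_compact_space[OF cpt_P clo_E] cont_comp_right[OF \<phi>E]]])
  let ?Y = "subtopology ?P L"
  have top_Y: "topspace ?Y = L"
    using closedin_subset[OF clo_L] by auto
  have "\<exists>u\<in>topspace ?Y. ?c u u = u"
  proof (rule Ellis_Numakura[where m = ?c])
    show "compact_space ?Y"
      by (rule compact_space_subtopology[OF closedin_compact_space[OF cpt_P clo_L]])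
    show "Hausdorff_space ?Y"
      by (rule Hausdorff_space_subtopology[OF haus_P])
    show "topspace ?Y \<noteq> {}"
      unfolding top_Y using \<phi>E unfolding L_def by blast
    have L_assoc: "?c (?c p q) r = ?c p (?c q r)" if "r \<in> E" for p q r
      using E_PiE that by (intro compose_assoc[symmetric]) blast
    show "continuous_map ?Y ?Y (\<lambda>p. ?c p q)" if "q \<in> topspace ?Y" for q
    proof -
      have q: "q \<in> L"
        using that top_Y by blast
      have "?c p q \<in> L" if "p \<in> L" for p
      proof -
        obtain q' where q': "q' \<in> E" "q = ?c q' \<phi>"
          using q by (auto simp: L_def)
        have "?c p q = ?c (?c p q') \<phi>"
          by (simp only: q'(2) L_assoc[OF \<phi>E])
        moreover have "?c p q' \<in> E"
          using E_comp that LE q'(1) by blast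
        ultimately show ?thesis
          unfolding L_def by blast
      qed
      then show ?thesis
        using cont_comp_right q LE
        by (intro continuous_map_into_subtopology continuous_map_from_subtopology) (auto simp: top_Y)
    qed
    show "?c (?c p q) r = ?c p (?c q r)"
      if "p \<in> topspace ?Y" "q \<in> topspace ?Y" "r \<in> topspace ?Y" for p q r
      using L_assoc that LE top_Y by blast
  qed
  then obtain u where u: "u \<in> L" "?c u u = u"
    using top_Y by blast
  then obtain \<psi> where \<psi>: "\<psi> \<in> E" "u = ?c \<psi> \<phi>"
    by (auto simp: L_def)
  have u_id: "u x = x" if "x \<in> ?S" for x
  proof -
    have "u (u x) = u x"
      using u(2) that by (metis compose_eq)
    then show ?thesis
      using inj[of u] u LE that E_in[of u x] by (auto dest: inj_onD)
  qed
  \<comment> \<open>The identity \<open>u\<close>, which is \<open>\<psi>\<close> after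
    \<open>\<phi>\<close>, is evaluated at \<open>\<psi> x\<close>, and the injective
    \<open>\<psi>\<close> is cancelled.\<close>
  have "\<phi> (\<psi> x) = x" if "x \<in> ?S" for x
  proof -
    have "\<psi> (\<phi> (\<psi> x)) = \<psi> x"
      using u_id[OF E_in[OF \<psi>(1) that]] E_in[OF \<psi>(1) that] by (simp add: \<psi>(2) compose_eq)
    then show ?thesis
      using inj[OF \<psi>(1)] that E_in \<psi>(1) \<phi>E by (auto dest: inj_onD)
  qed
  then have "?S \<subseteq> \<phi> ` ?S"
    using E_in[OF \<psi>(1)] by (metis image_eqI subsetI)
  then show ?thesis
    using E_in[OF \<phi>E] by blast
qed

section \<open>Limits in products and under maps\<close>

text \<open>Projection along a compact factor is a closed map. This takes the place of passing to a
  convergent subnet in the second coordinate.\<close>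

lemma closure_of_fst_compact:
  assumes "compact_space Y" "S \<subseteq> topspace X \<times> topspace Y" "x \<in> X closure_of fst ` S"
  shows "\<exists>y. (x, y) \<in> prod_topology X Y closure_of S"
proof -
  have "X closure_of fst ` S \<subseteq> fst ` (prod_topology X Y closure_of S)"
    using closed_map_fst[OF assms(1), of X] assms(2) by (simp add: closed_map_closure_of_image)
  then show ?thesis
    using assms(3) by force
qed

text \<open>Limits lift along open maps: a box around \<open>(x, y)\<close> has an open image, this
  image meets \<open>S\<close>, and preimages can be chosen inside the box. It serves to pull limits
  in the coset space back to the group.\<close>

lemma open_map_Pair_closure:
  assumes op: "open_map X Y f" and x: "x \<in> topspace X" "y \<in> topspace X"
    and clo: "(f x, f y) \<in> prod_topology Y Y closure_of S"
  shows "(x, y) \<in> prod_topology X X closure_of {(u, v). u \<in> topspace X \<and> v \<in> topspace X \<and> (f u, f v) \<in> S}"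
  unfolding in_closure_of
proof (intro conjI allI impI)
  show "(x, y) \<in> topspace (prod_topology X X)"
    using x by simp
  fix W assume "(x, y) \<in> W \<and> openin (prod_topology X X) W"
  then obtain U V where UV: "openin X U" "openin X V" "x \<in> U" "y \<in> V" "U \<times> V \<subseteq> W"
    unfolding openin_prod_topology_alt by blast
  have "openin (prod_topology Y Y) (f ` U \<times> f ` V)"
    using op UV by (auto simp: open_map_def openin_prod_Times_iff)
  moreover have "(f x, f y) \<in> f ` U \<times> f ` V"
    using UV by blast
  ultimately obtain s where "s \<in> S" "s \<in> f ` U \<times> f ` V"
    using clo unfolding in_closure_of by (elim conjE allE[of _ "f ` U \<times> f ` V"]) blast
  then obtain u v where uv: "u \<in> U" "v \<in> V" "(f u, f v) \<in> S"
    by blast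
  then show "\<exists>w. w \<in> {(u, v). u \<in> topspace X \<and> v \<in> topspace X \<and> (f u, f v) \<in> S} \<and> w \<in> W"
    using UV openin_subset by blast
qed


lemma closure_of_continuous_mapD:
  assumes "continuous_map X Y h" "a \<in> X closure_of S" "h ` S \<subseteq> S'"
  shows "h a \<in> Y closure_of S'"
  using continuous_map_image_closure_subset[OF assms(1), of S] assms(2) closure_of_mono[OF assms(3)]
  by blast

lemma distal_actionD:
  assumes "distal_action S X act" "x \<in> topspace X" "y \<in> topspace X" "a \<in> topspace X"
    and "(a, a) \<in> prod_topology X X closure_of ((\<lambda>g. (act g x, act g y)) ` S)"
  shows "x = y"
  using assms unfolding distal_action_def Setcompr_eq_image by blast

lemma distal_actionI:
  assumes "\<And>x y a. \<lbrakk>x \<in> topspace X; y \<in> topspace X; a \<in> topspace X;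
    (a, a) \<in> prod_topology X X closure_of ((\<lambda>g. (act g x, act g y)) ` S)\<rbrakk> \<Longrightarrow> x = y"
  shows "distal_action S X act"
  using assms unfolding distal_action_def Setcompr_eq_image by blast

text \<open>Lets an action indexed by automorphisms be read as the set of their restrictions to the
  compact subgroup.\<close>

lemma distal_action_image:
  "distal_action (f ` S) X act \<longleftrightarrow> distal_action S X (act \<circ> f)"
  by (simp add: distal_action_def Setcompr_eq_image image_image)

lemma distal_action_subtopology:
  assumes "distal_action S X act" and K: "K \<subseteq> topspace X"
  shows "distal_action S (subtopology X K) (\<lambda>g. restrict (act g) K)"
proof (rule distal_actionI)
  fix x y a
  assume xya: "x \<in> topspace (subtopology X K)" "y \<in> topspace (subtopology X K)"
    "a \<in> topspace (subtopology X K)"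
  assume "(a, a) \<in> prod_topology (subtopology X K) (subtopology X K) closure_of
    ((\<lambda>g. (restrict (act g) K x, restrict (act g) K y)) ` S)"
  moreover have "prod_topology (subtopology X K) (subtopology X K) = subtopology (prod_topology X X) (K \<times> K)"
    by (simp add: prod_topology_subtopology subtopology_subtopology Times_Int_Times inf.absorb2 K)
  moreover have "(\<lambda>g. (restrict (act g) K x, restrict (act g) K y)) ` S = (\<lambda>g. (act g x, act g y)) ` S"
    using xya by simp
  ultimately have "(a, a) \<in> prod_topology X X closure_of ((\<lambda>g. (act g x, act g y)) ` S)"
    using closure_of_subtopology_subset by fastforce
  then show "x = y"
    using xya by (intro distal_actionD[OF assms(1)]) auto
qed

section \<open>Topological groups, coset spaces and distality at the identity\<close>

context topological_group
begin

lemma continuous_map_mult: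
  assumes "continuous_map X T f" "continuous_map X T g"
  shows "continuous_map X T (\<lambda>x. f x \<otimes> g x)"
  using continuous_map_compose[OF continuous_map_pairedI[OF assms] continuous_mult]
  by (simp add: o_def)

lemma continuous_map_m_inv:
  assumes "continuous_map X T f"
  shows "continuous_map X T (\<lambda>x. inv (f x))"
  using continuous_map_compose[OF assms continuous_inv] by (simp add: o_def)

lemma l_coset_eq_iff:
  assumes K: "subgroup K G" and xy: "x \<in> carrier G" "y \<in> carrier G"
  shows "x <# K = y <# K \<longleftrightarrow> inv x \<otimes> y \<in> K"
proof
  assume "x <# K = y <# K"
  then have "y \<in> x <# K"
    using lcos_self[OF xy(2) K] by simp
  then show "inv x \<otimes> y \<in> K"
    by (rule subgroup.lcos_module_imp[OF K is_group xy(1)])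
next
  assume "inv x \<otimes> y \<in> K"
  then have "y \<in> x <# K"
    by (rule subgroup.lcos_module_rev[OF K is_group xy])
  then show "x <# K = y <# K"
    by (rule l_repr_independence[OF _ xy(1) K])
qed

lemma continuous_map_l_coset: "continuous_map T (coset_space G T K) (\<lambda>x. x <# K)"
  unfolding coset_space_def by (rule quotient_imp_continuous_map[OF quotient_map_quotient_topology])

text \<open>The preimage of the image of \<open>U\<close> is the union of the right translates of
  \<open>U\<close> by elements of \<open>K\<close>, and right translations are continuous.\<close>

lemma open_map_l_coset:
  assumes K: "subgroup K G"
  shows "open_map T (coset_space G T K) (\<lambda>x. x <# K)"
  unfolding open_map_def
proof (intro allI impI)
  fix U assume U: "openin T U"
  have sub: "U \<subseteq> carrier G"
    using openin_subset[OF U] by (simp add: topspace_eq_carrier)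
  have K_carrier: "k \<in> carrier G" if "k \<in> K" for k
    using subgroup.mem_carrier[OF K that] .
  have "{x \<in> topspace T. x <# K \<in> (\<lambda>x. x <# K) ` U} = (\<Union>k\<in>K. {x \<in> topspace T. x \<otimes> k \<in> U})"
  proof (intro equalityI subsetI)
    fix x assume "x \<in> {x \<in> topspace T. x <# K \<in> (\<lambda>x. x <# K) ` U}"
    then obtain u where u: "x \<in> carrier G" "u \<in> U" "x <# K = u <# K"
      by (auto simp: topspace_eq_carrier)
    then have "inv x \<otimes> u \<in> K"
      using l_coset_eq_iff[OF K u(1)] sub by blast
    moreover have "x \<otimes> (inv x \<otimes> u) = u"
      using u sub by (simp add: subset_iff m_assoc[symmetric])
    ultimately show "x \<in> (\<Union>k\<in>K. {x \<in> topspace T. x \<otimes> k \<in> U})"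
      using u by (auto simp: topspace_eq_carrier intro!: bexI[of _ "inv x \<otimes> u"])
  next
    fix x assume "x \<in> (\<Union>k\<in>K. {x \<in> topspace T. x \<otimes> k \<in> U})"
    then obtain k where k: "k \<in> K" "x \<in> carrier G" "x \<otimes> k \<in> U"
      by (auto simp: topspace_eq_carrier)
    then have "inv x \<otimes> (x \<otimes> k) = k"
      by (simp add: K_carrier m_assoc[symmetric])
    then have "x <# K = (x \<otimes> k) <# K"
      using l_coset_eq_iff[OF K k(2), of "x \<otimes> k"] k K_carrier by simp
    then show "x \<in> {x \<in> topspace T. x <# K \<in> (\<lambda>x. x <# K) ` U}"
      using k by (auto simp: topspace_eq_carrier)
  qed
  moreover have "openin T {x \<in> topspace T. x \<otimes> k \<in> U}" if "k \<in> K" for k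
    using that K_carrier U
    by (intro openin_continuous_map_preimage[where Y = T] continuous_map_mult)
      (auto simp: topspace_eq_carrier)
  ultimately have "openin T {x \<in> topspace T. x <# K \<in> (\<lambda>x. x <# K) ` U}"
    by auto
  then show "openin (coset_space G T K) ((\<lambda>x. x <# K) ` U)"
    using openin_subset[OF U] unfolding coset_space_def openin_quotient_topology by blast
qed

lemma hom_inv_mult:
  assumes "\<gamma> \<in> hom G G" "x \<in> carrier G" "y \<in> carrier G"
  shows "\<gamma> (inv x \<otimes> y) = inv (\<gamma> x) \<otimes> \<gamma> y"
  using assms hom_mult[OF assms(1)] group_hom.hom_inv[of G G \<gamma>]
  by (auto simp: group_hom_def group_hom_axioms_def is_group)

text \<open>The map \<open>\<lambda>p. inv (fst p) \<otimes> snd p\<close> sends the diagonal to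
  \<open>\<one>\<close> and the orbit of \<open>(x, y)\<close> to that of
  \<open>inv x \<otimes> y\<close>. In the other direction, automorphisms fix \<open>\<one>\<close>,
  so accumulation of the orbit of \<open>z\<close> at \<open>\<one>\<close> is accumulation of the
  orbit of \<open>(z, \<one>)\<close> at the diagonal.\<close>

lemma distal_action_iff_one:
  assumes "\<Gamma> \<subseteq> hom G G"
  shows "distal_action \<Gamma> T (\<lambda>\<gamma>. \<gamma>) \<longleftrightarrow>
    (\<forall>z\<in>carrier G. \<one> \<in> T closure_of ((\<lambda>\<gamma>. \<gamma> z) ` \<Gamma>) \<longrightarrow> z = \<one>)"
proof -
  have hom: "\<gamma> \<in> hom G G" if "\<gamma> \<in> \<Gamma>" for \<gamma>
    using assms that by blast
  show ?thesis
  proof (intro iffI ballI impI)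
    fix z assume distal: "distal_action \<Gamma> T (\<lambda>\<gamma>. \<gamma>)" and z: "z \<in> carrier G"
      and clo: "\<one> \<in> T closure_of ((\<lambda>\<gamma>. \<gamma> z) ` \<Gamma>)"
    have "continuous_map T (prod_topology T T) (\<lambda>g. (g, \<one>))"
      by (intro continuous_map_pairedI) (auto simp: topspace_eq_carrier)
    from closure_of_continuous_mapD[OF this clo subset_refl]
    have "(\<one>, \<one>) \<in> prod_topology T T closure_of ((\<lambda>\<gamma>. (\<gamma> z, \<one>)) ` \<Gamma>)"
      by (simp add: image_image)
    also have "(\<lambda>\<gamma>. (\<gamma> z, \<one>)) ` \<Gamma> = (\<lambda>\<gamma>. (\<gamma> z, \<gamma> \<one>)) ` \<Gamma>"
      by (rule image_cong) (simp_all add: hom_one[OF hom is_group is_group])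
    finally have "(\<one>, \<one>) \<in> prod_topology T T closure_of ((\<lambda>\<gamma>. (\<gamma> z, \<gamma> \<one>)) ` \<Gamma>)" .
    then show "z = \<one>"
      using z by (intro distal_actionD[OF distal]) (auto simp: topspace_eq_carrier)
  next
    assume one: "\<forall>z\<in>carrier G. \<one> \<in> T closure_of ((\<lambda>\<gamma>. \<gamma> z) ` \<Gamma>) \<longrightarrow> z = \<one>"
    show "distal_action \<Gamma> T (\<lambda>\<gamma>. \<gamma>)"
    proof (rule distal_actionI)
      fix x y a assume "x \<in> topspace T" "y \<in> topspace T" "a \<in> topspace T"
        and clo: "(a, a) \<in> prod_topology T T closure_of ((\<lambda>\<gamma>. (\<gamma> x, \<gamma> y)) ` \<Gamma>)"
      then have xy: "x \<in> carrier G" "y \<in> carrier G" "a \<in> carrier G"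
        by (simp_all add: topspace_eq_carrier)
      have "continuous_map (prod_topology T T) T (\<lambda>p. inv (fst p) \<otimes> snd p)"
        by (intro continuous_map_mult continuous_map_m_inv continuous_map_fst continuous_map_snd)
      from closure_of_continuous_mapD[OF this clo subset_refl]
      have "inv a \<otimes> a \<in> T closure_of ((\<lambda>\<gamma>. inv (\<gamma> x) \<otimes> \<gamma> y) ` \<Gamma>)"
        by (simp add: image_image)
      also have "(\<lambda>\<gamma>. inv (\<gamma> x) \<otimes> \<gamma> y) ` \<Gamma> = (\<lambda>\<gamma>. \<gamma> (inv x \<otimes> y)) ` \<Gamma>"
        by (rule image_cong) (simp_all add: hom_inv_mult[OF hom xy(1,2)])
      finally have "inv x \<otimes> y = \<one>"
        using one xy by simp
      then show "x = y"
        using xy by (metis inv_equality inv_inv inv_closed)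
    qed
  qed
qed

section \<open>Limits modulo the compact subgroup\<close>

text \<open>The limit \<open>k\<close> is also a limit of the orbit of some \<open>k'\<close> in
  \<open>K\<close>, along the same automorphisms; distality of the group then forces
  \<open>z = k'\<close>.\<close>

lemma orbit_closure_meets_compact_subgroup:
  assumes haus: "Hausdorff_space T"
    and auto: "\<Gamma> \<subseteq> auto G"
    and cont: "\<And>\<gamma>. \<gamma> \<in> \<Gamma> \<Longrightarrow> continuous_map T T \<gamma>"
    and mult: "\<And>\<gamma> \<delta>. \<gamma> \<in> \<Gamma> \<Longrightarrow> \<delta> \<in> \<Gamma> \<Longrightarrow> \<gamma> \<otimes>\<^bsub>AutoGroup G\<^esub> \<delta> \<in> \<Gamma>"
    and K: "subgroup K G" "compactin T K"
    and inv_K: "\<And>\<gamma>. \<gamma> \<in> \<Gamma> \<Longrightarrow> \<gamma> ` K = K"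
    and distal: "distal_action \<Gamma> T (\<lambda>\<gamma>. \<gamma>)"
    and z: "z \<in> carrier G" and k: "k \<in> K" "k \<in> T closure_of ((\<lambda>\<gamma>. \<gamma> z) ` \<Gamma>)"
  shows "z \<in> K"
proof -
  let ?X = "subtopology T K"
  let ?P = "product_topology (\<lambda>_. ?X) K"
  let ?F = "(\<lambda>\<gamma>. restrict \<gamma> K) ` \<Gamma>"
  have KT: "K \<subseteq> topspace T" and KG: "K \<subseteq> carrier G"
    using compactin_subset_topspace[OF K(2)] by (simp_all add: topspace_eq_carrier)
  have top_X: "topspace ?X = K"
    using KT by auto
  have cpt_X: "compact_space ?X"
    by (rule compact_space_subtopology[OF K(2)])
  have hom: "\<gamma> \<in> hom G G" if "\<gamma> \<in> \<Gamma>" for \<gamma>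
    using auto that by (auto simp: auto_def)
  have in_K: "\<gamma> x \<in> K" if "\<gamma> \<in> \<Gamma>" "x \<in> K" for \<gamma> x
    using inv_K that by blast
  have cpt_P: "compact_space ?P"
    using cpt_X by (simp add: compact_space_product_topology)
  \<comment> \<open>Pairing the orbit point with the restriction ensures that \<open>k\<close> and
    \<open>\<phi>\<close> arise as one simultaneous limit.\<close>
  define S where "S = (\<lambda>\<gamma>. (\<gamma> z, restrict \<gamma> K)) ` \<Gamma>"
  have "S \<subseteq> topspace T \<times> topspace ?P"
    unfolding S_def
  proof (intro image_subsetI SigmaI)
    fix \<gamma> assume \<gamma>: "\<gamma> \<in> \<Gamma>"
    show "\<gamma> z \<in> topspace T"
      by (simp add: topspace_eq_carrier hom_in_carrier[OF hom[OF \<gamma>] z])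
    show "restrict \<gamma> K \<in> topspace ?P"
      using in_K[OF \<gamma>] top_X by (simp add: PiE_def Pi_def)
  qed
  moreover have "k \<in> T closure_of fst ` S"
    using k by (simp add: S_def image_image)
  ultimately have "\<exists>\<phi>. (k, \<phi>) \<in> prod_topology T ?P closure_of S"
    by (rule closure_of_fst_compact[OF cpt_P])
  then obtain \<phi> where \<phi>: "(k, \<phi>) \<in> prod_topology T ?P closure_of S" ..
  have "\<phi> \<in> ?P closure_of ?F"
    by (rule closure_of_continuous_mapD[OF continuous_map_snd \<phi>, unfolded snd_conv])
      (simp add: S_def image_image)
  then have "\<phi> ` K = K"
  proof (rule distal_closure_surjective[of ?X ?F \<phi>, unfolded top_X, rotated -1])
    show "compact_space ?X" "Hausdorff_space ?X"
      by (rule cpt_X, rule Hausdorff_space_subtopology[OF haus])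
    show "continuous_map ?X ?X f" if f: "f \<in> ?F" for f
    proof -
      obtain \<gamma> where "\<gamma> \<in> \<Gamma>" "f = restrict \<gamma> K"
        using f by blast
      moreover from this have "continuous_map ?X ?X \<gamma>"
        using in_K cont
        by (intro continuous_map_into_subtopology continuous_map_from_subtopology) (auto simp: top_X)
      ultimately show ?thesis
        by (metis continuous_map_eq restrict_apply' top_X)
    qed
    show "?F \<subseteq> extensional K"
      by auto
    show "compose K f g \<in> ?F" if fg: "f \<in> ?F" "g \<in> ?F" for f g
    proof -
      obtain \<gamma> \<delta> where \<gamma>\<delta>: "\<gamma> \<in> \<Gamma>" "f = restrict \<gamma> K" "\<delta> \<in> \<Gamma>" "g = restrict \<delta> K"
        using fg by blast
      \<comment> \<open>The product in \<open>AutoGroup G\<close> is composition cut down to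
        \<open>carrier G\<close>, which agrees on \<open>K\<close> with composition of the
        restrictions.\<close>
      have "\<gamma> \<otimes>\<^bsub>AutoGroup G\<^esub> \<delta> = compose (carrier G) \<gamma> \<delta>"
        using auto \<gamma>\<delta> by (auto simp: AutoGroup_def BijGroup_def auto_def)
      moreover have "compose K f g = restrict (compose (carrier G) \<gamma> \<delta>) K"
        using \<gamma>\<delta> inv_K[of \<delta>] KG by (auto simp: compose_def fun_eq_iff)
      ultimately show ?thesis
        using mult[OF \<gamma>\<delta>(1,3)] by (metis imageI)
    qed
    show "distal_action ?F ?X (\<lambda>f. f)"
      using distal_action_subtopology[OF distal KT] by (simp add: distal_action_image o_def)
  qed
  then obtain k' where k': "k' \<in> K" "\<phi> k' = k"
    using k(1) by (metis imageE)
  have k'G: "k' \<in> carrier G" "k \<in> carrier G"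
    using k' k KG by auto
  \<comment> \<open>Evaluation at \<open>k'\<close> is a coordinate projection of \<open>?P\<close>.
    The map takes \<open>(k, \<phi>)\<close> to \<open>inv k \<otimes> k\<close>, and the points of
    \<open>S\<close> to the orbit of \<open>inv k' \<otimes> z\<close>.\<close>
  have "continuous_map (prod_topology T ?P) T (\<lambda>p. inv (snd p k') \<otimes> fst p)"
    using continuous_map_into_fulltopology[OF continuous_map_prod_snd[OF k'(1), of T ?X]]
    by (intro continuous_map_mult continuous_map_m_inv continuous_map_fst)
  from closure_of_continuous_mapD[OF this \<phi> subset_refl]
  have "inv k \<otimes> k \<in> T closure_of ((\<lambda>\<gamma>. inv (\<gamma> k') \<otimes> \<gamma> z) ` \<Gamma>)"
    using k' by (simp add: S_def image_image)
  also have "(\<lambda>\<gamma>. inv (\<gamma> k') \<otimes> \<gamma> z) ` \<Gamma> = (\<lambda>\<gamma>. \<gamma> (inv k' \<otimes> z)) ` \<Gamma>"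
    by (rule image_cong) (simp_all add: hom_inv_mult[OF hom k'G(1) z])
  finally have "inv k' \<otimes> z = \<one>"
    using distal distal_action_iff_one[of \<Gamma>] hom z k'G by (simp add: subsetI)
  then have "z = k'"
    using z k'G by (metis inv_equality inv_inv inv_closed)
  then show ?thesis
    using k' by simp
qed

text \<open>Openness of the coset projection lifts the limit to \<open>(a, a)\<close>, approached by
  pairs \<open>(x i \<otimes> k, y i \<otimes> l)\<close> with \<open>k\<close> and \<open>l\<close>
  in \<open>K\<close>. By compactness these correction factors accumulate as well, and removing them
  leaves a limit in \<open>K\<close>.\<close>

lemma closure_of_l_coset_pairs:
  assumes K: "subgroup K G" "compactin T K"
    and x: "\<And>i. i \<in> I \<Longrightarrow> x i \<in> carrier G" and y: "\<And>i. i \<in> I \<Longrightarrow> y i \<in> carrier G"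
    and a: "a \<in> carrier G"
    and clo: "(a <# K, a <# K) \<in> prod_topology (coset_space G T K) (coset_space G T K) closure_of
      ((\<lambda>i. (x i <# K, y i <# K)) ` I)"
  shows "\<exists>k\<in>K. k \<in> T closure_of ((\<lambda>i. inv (x i) \<otimes> y i) ` I)"
proof -
  let ?X = "subtopology T K"
  let ?KK = "prod_topology ?X ?X"
  have KT: "K \<subseteq> topspace T" and KG: "K \<subseteq> carrier G"
    using compactin_subset_topspace[OF K(2)] by (simp_all add: topspace_eq_carrier)
  have top_X: "topspace ?X = K"
    using KT by auto
  have cpt: "compact_space ?KK"
    using compact_space_subtopology[OF K(2)] by (simp add: compact_space_prod_topology)
  \<comment> \<open>The correction factors are recorded next to the corrected pair, so that
    \<open>closure_of_fst_compact\<close> produces a joint limit.\<close>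
  define S where "S = (\<lambda>(i, k, l). ((x i \<otimes> k, y i \<otimes> l), (k, l))) ` (I \<times> K \<times> K)"
  have lift: "\<exists>k\<in>K. u = v \<otimes> k" if "u \<in> carrier G" "v \<in> carrier G" "u <# K = v <# K" for u v
  proof
    show "inv v \<otimes> u \<in> K"
      using l_coset_eq_iff[OF K(1) that(2,1)] that(3) by simp
    show "u = v \<otimes> (inv v \<otimes> u)"
      using that by (simp add: m_assoc[symmetric])
  qed
  have "(a, a) \<in> prod_topology T T closure_of {(u, v). u \<in> topspace T \<and> v \<in> topspace T \<and>
      (u <# K, v <# K) \<in> (\<lambda>i. (x i <# K, y i <# K)) ` I}"
    using open_map_Pair_closure[OF open_map_l_coset[OF K(1)] _ _ clo] a
    by (simp add: topspace_eq_carrier)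
  moreover have "{(u, v). u \<in> topspace T \<and> v \<in> topspace T \<and>
      (u <# K, v <# K) \<in> (\<lambda>i. (x i <# K, y i <# K)) ` I} \<subseteq> fst ` S"
  proof clarify
    fix u v i assume uv: "u \<in> topspace T" "v \<in> topspace T" and i: "i \<in> I"
      and "u <# K = x i <# K" "v <# K = y i <# K"
    then obtain k l where "k \<in> K" "l \<in> K" "u = x i \<otimes> k" "v = y i \<otimes> l"
      using lift x y by (metis topspace_eq_carrier)
    then show "(u, v) \<in> fst ` S"
      using i by (force simp: S_def)
  qed
  ultimately have "(a, a) \<in> prod_topology T T closure_of fst ` S"
    using closure_of_mono by blast
  moreover have "S \<subseteq> topspace (prod_topology T T) \<times> topspace ?KK"
    using x y KG by (auto simp: S_def topspace_eq_carrier)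
  ultimately obtain k l where
    kl: "((a, a), (k, l)) \<in> prod_topology (prod_topology T T) ?KK closure_of S"
    using closure_of_fst_compact[OF cpt] by (metis surj_pair)
  then have "((a, a), (k, l)) \<in> topspace (prod_topology (prod_topology T T) ?KK)"
    by (rule subsetD[OF closure_of_subset_topspace])
  then have kl_K: "k \<in> K" "l \<in> K"
    by auto
  \<comment> \<open>This map undoes the corrections on \<open>S\<close>; at the limit point
    \<open>inv a \<otimes> a\<close> cancels and \<open>k \<otimes> inv l\<close> remains.\<close>
  have h_cont: "continuous_map (prod_topology (prod_topology T T) ?KK) T
      (\<lambda>p. fst (snd p) \<otimes> (inv (fst (fst p)) \<otimes> snd (fst p)) \<otimes> inv (snd (snd p)))"
  proof -
    let ?Z = "prod_topology (prod_topology T T) ?KK"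
    have "continuous_map ?Z T (fst \<circ> fst)" "continuous_map ?Z T (snd \<circ> fst)"
      by (rule continuous_map_compose[OF continuous_map_fst continuous_map_fst]
          continuous_map_compose[OF continuous_map_fst continuous_map_snd])+
    moreover have "continuous_map ?Z T (fst \<circ> snd)" "continuous_map ?Z T (snd \<circ> snd)"
      by (rule continuous_map_into_fulltopology[OF continuous_map_compose[OF continuous_map_snd continuous_map_fst]]
          continuous_map_into_fulltopology[OF continuous_map_compose[OF continuous_map_snd continuous_map_snd]])+
    ultimately show ?thesis
      unfolding o_def by (intro continuous_map_mult continuous_map_m_inv)
  qed
  have h_S: "(\<lambda>p. fst (snd p) \<otimes> (inv (fst (fst p)) \<otimes> snd (fst p)) \<otimes> inv (snd (snd p))) ` S
      \<subseteq> (\<lambda>i. inv (x i) \<otimes> y i) ` I"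
  proof -
    have "k \<otimes> (inv (x i \<otimes> k) \<otimes> (y i \<otimes> l)) \<otimes> inv l = inv (x i) \<otimes> y i"
      if "i \<in> I" "k \<in> K" "l \<in> K" for i k l
    proof -
      have G: "k \<in> carrier G" "l \<in> carrier G" "x i \<in> carrier G" "y i \<in> carrier G"
        using that x y KG by auto
      have "k \<otimes> (inv (x i \<otimes> k) \<otimes> (y i \<otimes> l)) \<otimes> inv l
          = (k \<otimes> inv k) \<otimes> inv (x i) \<otimes> y i \<otimes> (l \<otimes> inv l)"
        using G by (simp only: m_assoc inv_mult_group m_closed inv_closed)
      then show ?thesis
        using G by simp
    qed
    then show ?thesis
      by (auto simp: S_def)
  qed
  have "k \<otimes> inv l \<in> T closure_of ((\<lambda>i. inv (x i) \<otimes> y i) ` I)"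
    using closure_of_continuous_mapD[OF h_cont kl h_S] a kl_K KG by (simp add: subset_iff)
  moreover have "k \<otimes> inv l \<in> K"
    using kl_K K(1) by (simp add: subgroup.m_closed subgroup.m_inv_closed)
  ultimately show ?thesis
    by blast
qed

end

section \<open>Transfer of distality between the group, the subgroup and the coset space\<close>

theorem theorem3p1:
  fixes G :: "('a, 'b) monoid_scheme" (structure)
    and T :: "'a topology"
    and \<Gamma> :: "('a \<Rightarrow> 'a) set"
    and K :: "'a set"
  assumes "topological_group G T"
    and "Hausdorff_space T"
    and "\<Gamma> \<subseteq> auto G"
    and "\<And>\<gamma>. \<gamma> \<in> \<Gamma> \<Longrightarrow> homeomorphic_map T T \<gamma>"
    and "\<And>\<gamma> \<delta>. \<gamma> \<in> \<Gamma> \<Longrightarrow> \<delta> \<in> \<Gamma> \<Longrightarrow> \<gamma> \<otimes>\<^bsub>AutoGroup G\<^esub> \<delta> \<in> \<Gamma>"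
    and "subgroup K G"
    and "compactin T K"
    and "\<And>\<gamma>. \<gamma> \<in> \<Gamma> \<Longrightarrow> \<gamma> ` K = K"
  shows "distal_action \<Gamma> T (\<lambda>\<gamma>. \<gamma>) \<longleftrightarrow>
      distal_action \<Gamma> (subtopology T K) (\<lambda>\<gamma>. restrict \<gamma> K) \<and>
      distal_action \<Gamma> (coset_space G T K) (coset_map G K)"
proof -
  interpret topological_group G T by fact
  note K = \<open>subgroup K G\<close> \<open>compactin T K\<close>
  let ?\<pi> = "\<lambda>x. x <# K" and ?Q = "coset_space G T K"
  have KT: "K \<subseteq> topspace T"
    by (rule compactin_subset_topspace[OF K(2)])
  have hom: "\<gamma> \<in> hom G G" if "\<gamma> \<in> \<Gamma>" for \<gamma>
    using assms(3) that by (auto simp: auto_def)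
  have cont: "continuous_map T T \<gamma>" if "\<gamma> \<in> \<Gamma>" for \<gamma>
    using assms(4)[OF that] by (rule homeomorphic_imp_continuous_map)
  have coset: "coset_map G K \<gamma> (?\<pi> x) = ?\<pi> (\<gamma> x)" if "\<gamma> \<in> \<Gamma>" "x \<in> carrier G" for \<gamma> x
    using coset_map_l_coset[OF K(1) hom[OF that(1)] _ that(2)] assms(8)[OF that(1)] by simp
  have top_Q: "topspace ?Q = ?\<pi> ` carrier G"
    by (auto simp: topspace_coset_space LCOSETS_def)
  show ?thesis
  proof (intro iffI conjI)
    assume distal: "distal_action \<Gamma> T (\<lambda>\<gamma>. \<gamma>)"
    show "distal_action \<Gamma> (subtopology T K) (\<lambda>\<gamma>. restrict \<gamma> K)"
      by (rule distal_action_subtopology[OF distal KT])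
    show "distal_action \<Gamma> ?Q (coset_map G K)"
    proof (rule distal_actionI)
      fix X Y A assume "X \<in> topspace ?Q" "Y \<in> topspace ?Q" "A \<in> topspace ?Q"
      then obtain x y a where x: "x \<in> carrier G" "X = ?\<pi> x" and y: "y \<in> carrier G" "Y = ?\<pi> y"
        and a: "a \<in> carrier G" "A = ?\<pi> a"
        unfolding top_Q by blast
      assume clo: "(A, A) \<in> prod_topology ?Q ?Q closure_of
        ((\<lambda>\<gamma>. (coset_map G K \<gamma> X, coset_map G K \<gamma> Y)) ` \<Gamma>)"
      have "(\<lambda>\<gamma>. (coset_map G K \<gamma> X, coset_map G K \<gamma> Y)) ` \<Gamma> = (\<lambda>\<gamma>. (?\<pi> (\<gamma> x), ?\<pi> (\<gamma> y))) ` \<Gamma>"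
        unfolding x(2) y(2) by (rule image_cong) (simp_all add: coset x(1) y(1))
      with clo have "(?\<pi> a, ?\<pi> a) \<in> prod_topology ?Q ?Q closure_of ((\<lambda>\<gamma>. (?\<pi> (\<gamma> x), ?\<pi> (\<gamma> y))) ` \<Gamma>)"
        unfolding a(2) by simp
      then have "\<exists>k\<in>K. k \<in> T closure_of ((\<lambda>\<gamma>. inv (\<gamma> x) \<otimes> \<gamma> y) ` \<Gamma>)"
        by (intro closure_of_l_coset_pairs[where x = "\<lambda>\<gamma>. \<gamma> x" and y = "\<lambda>\<gamma>. \<gamma> y", OF K _ _ a(1)])
          (auto intro: hom_in_carrier[OF hom] x(1) y(1))
      then obtain k where k: "k \<in> K" "k \<in> T closure_of ((\<lambda>\<gamma>. inv (\<gamma> x) \<otimes> \<gamma> y) ` \<Gamma>)" ..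
      have "(\<lambda>\<gamma>. inv (\<gamma> x) \<otimes> \<gamma> y) ` \<Gamma> = (\<lambda>\<gamma>. \<gamma> (inv x \<otimes> y)) ` \<Gamma>"
        by (rule image_cong) (simp_all add: hom_inv_mult[OF hom x(1) y(1)])
      with k(2) have k': "k \<in> T closure_of ((\<lambda>\<gamma>. \<gamma> (inv x \<otimes> y)) ` \<Gamma>)"
        by simp
      have "inv x \<otimes> y \<in> K"
        by (rule orbit_closure_meets_compact_subgroup[OF assms(2,3) _ _ K _ distal _ k(1) k'])
          (simp_all add: cont assms(5,8) x(1) y(1))
      then show "X = Y"
        using l_coset_eq_iff[OF K(1) x(1) y(1)] x y by simp
    qed
  next
    assume "distal_action \<Gamma> (subtopology T K) (\<lambda>\<gamma>. restrict \<gamma> K) \<and>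
      distal_action \<Gamma> ?Q (coset_map G K)"
    then have dK: "distal_action \<Gamma> (subtopology T K) (\<lambda>\<gamma>. restrict \<gamma> K)"
      and dQ: "distal_action \<Gamma> ?Q (coset_map G K)"
      by auto
    have one_K: "\<one> \<in> K"
      by (rule subgroup.one_closed[OF K(1)])
    have hom_1: "\<gamma> \<one> = \<one>" if "\<gamma> \<in> \<Gamma>" for \<gamma>
      by (rule hom_one[OF hom[OF that] is_group is_group])
    show "distal_action \<Gamma> T (\<lambda>\<gamma>. \<gamma>)"
    proof (rule distal_action_iff_one[THEN iffD2], use hom in blast, intro ballI impI)
      fix z assume z: "z \<in> carrier G" and clo: "\<one> \<in> T closure_of ((\<lambda>\<gamma>. \<gamma> z) ` \<Gamma>)"
      \<comment> \<open>This map carries the limit \<open>\<one>\<close> to a diagonal limit of the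
        orbit of \<open>(?\<pi> z, ?\<pi> \<one>)\<close>, so distality of the coset space puts
        \<open>z\<close> in \<open>K\<close>.\<close>
      have "continuous_map T (prod_topology ?Q ?Q) (\<lambda>g. (?\<pi> g, ?\<pi> \<one>))"
        using top_Q by (intro continuous_map_pairedI continuous_map_l_coset) auto
      then have "(?\<pi> \<one>, ?\<pi> \<one>) \<in> prod_topology ?Q ?Q closure_of
          ((\<lambda>\<gamma>. (coset_map G K \<gamma> (?\<pi> z), coset_map G K \<gamma> (?\<pi> \<one>))) ` \<Gamma>)"
        by (rule closure_of_continuous_mapD[OF _ clo]) (auto simp: coset z hom_1)
      then have "?\<pi> z = ?\<pi> \<one>"
        using z top_Q by (intro distal_actionD[OF dQ]) auto
      then have zK: "z \<in> K"
        using l_coset_eq_iff[OF K(1) one_closed z] z by simp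
      have "(\<lambda>\<gamma>. \<gamma> z) ` \<Gamma> \<subseteq> K"
        using assms(8) zK by blast
      \<comment> \<open>As the orbit now lies in \<open>K\<close>, its limit \<open>\<one>\<close>
        is also a limit in the subspace, where distality applies to \<open>z\<close> and
        \<open>\<one>\<close>.\<close>
      then have clo_K: "\<one> \<in> subtopology T K closure_of ((\<lambda>\<gamma>. \<gamma> z) ` \<Gamma>)"
        using clo one_K by (simp add: closure_of_subtopology Int_absorb1)
      have "continuous_map (subtopology T K) (prod_topology (subtopology T K) (subtopology T K)) (\<lambda>g. (g, \<one>))"
        using one_K KT by (intro continuous_map_pairedI) auto
      then have "(\<one>, \<one>) \<in> prod_topology (subtopology T K) (subtopology T K) closure_of
          ((\<lambda>\<gamma>. (restrict \<gamma> K z, restrict \<gamma> K \<one>)) ` \<Gamma>)"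
        by (rule closure_of_continuous_mapD[OF _ clo_K]) (auto simp: zK one_K hom_1)
      then show "z = \<one>"
        using zK one_K KT by (intro distal_actionD[OF dK]) auto
    qed
  qed
qed

end
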